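(* Let $\mathcal{H}=(\mathbb{A},\mathsf{St},\{\mathsf{Act}_a\},\{\mathsf{act}_a\},\mathsf{out},H)$ be a concurrent game Hintikka structure for an $\mathrm{ATL}^{+}$ state formula $\eta$, and let $\mathcal{M}$ be the concurrent game model with the same agents, states, actions and transitions and with labelling $L(s)=H(s)\cap\mathrm{Prop}$ for every $s\in\mathsf{St}$. Then for every $s\in\mathsf{St}$ and every $\mathrm{ATL}^{+}$ state formula $\varphi$, $\varphi\in H(s)$ implies $\mathcal{M},s\models\varphi$. In particular, $\mathcal{M}$ satisfies $\eta$.
   Context: $\mathrm{ATL}^{+}$ over agents $\mathbb{A}$ and atoms $\mathrm{Prop}$, in negation normal form: state formulae $\varphi::=l\mid\varphi\vee\varphi\mid\varphi\wedge\varphi\mid\langle\langle A\rangle\rangle\Phi\mid[[A]]\Phi$ ($l$ a literal), path formulae $\Phi::=\varphi\mid\bigcirc\varphi\mid\Box\varphi\mid\varphi\,\mathcal{U}\,\varphi\mid\Phi\vee\Phi\mid\Phi\wedge\Phi$; $\top:=p\vee\neg p$. Semantics over concurrent game models (deterministic transitions $\mathsf{out}(s,\sigma)$ for action profiles $\sigma$) with perfect-recall strategies: $\langle\langle A\rangle\rangle\Phi$ holds at $s$ iff some strategy of $A$ (map from histories to available $A$-actions) forces $\Phi$ on all consistent plays from $s$; $[[A]]\Phi$ iff some $A$-co-strategy (map giving, for each history and strategy of $A$, an available action tuple of $\mathbb{A}\setminus A$) forces $\Phi$ on all plays consistent with it. For an $A$-action $\sigma_A$ at $s$, $\mathsf{Out}(s,\sigma_A)$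 is the set of $\mathsf{out}(s,\sigma)$ for profiles $\sigma$ extending $\sigma_A$; an $A$-co-action $\sigma^c_A$ at $s$ maps each $A$-action to an action tuple of $\mathbb{A}\setminus A$, and $\mathsf{Out}(s,\sigma^c_A)$ is the set of outcomes of profiles combining some $\sigma_A$ with $\sigma^c_A(\sigma_A)$. Components: $\varphi\wedge\psi$ is an $\alpha$-formula with components $\varphi,\psi$ (and $[[\mathbb{A}]]\bigcirc\psi$ one with component $\langle\langle\emptyset\rangle\rangle\bigcirc\psi$); $\varphi\vee\psi$ is a $\beta$-formula with components $\varphi,\psi$. Decomposition: $\mathsf{dec}(\varphi)=\{\langle\varphi,\top\rangle\}$ for state formulae; $\mathsf{dec}(\bigcirc\varphi)=\{\langle\top,\varphi\rangle\}$; $\mathsf{dec}(\Box\varphi)=\{\langle\varphi,\Box\varphi\rangle\}$; $\mathsf{dec}(\varphi\,\mathcal{U}\,\psi)=\{\langle\varphi,\varphi\,\mathcal{U}\,\psi\rangle,\langle\psi,\top\rangle\}$; $\mathsf{dec}(\Phi_1\wedge\Phi_2)=\{\langle\psi_i\wedge\psi_j,\Psi_i\wedge\Psi_j\rangle\}$ over $\mathsf{dec}(\Phi_1)\times\mathsf{dec}(\Phi_2)$; $\mathsf{dec}(\Phi_1\vee\Phi_2)=\mathsf{dec}(\Phi_1)\cup\mathsf{dec}(\Phi_2)\cup\{\langle\psi_i\wedge\psi_j,\Psi_i\vee\Psi_j\rangle:\Psi_i\neq\top\neq\Psi_j\}$. A $\gamma$-formula (potential eventuality) is $\langle\langle A\rangle\rangle\Phi$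 or $[[A]]\Phi$ with main operator of $\Phi$ not $\bigcirc$; its $\gamma$-components are, for $\langle\psi,\Psi\rangle\in\mathsf{dec}(\Phi)$, $\psi$ if $\Psi=\top$ and otherwise $\psi\wedge\langle\langle A\rangle\rangle\bigcirc\langle\langle A\rangle\rangle\Psi$ (resp. $\psi\wedge[[A]]\bigcirc[[A]]\Psi$), in which case $\langle\langle A\rangle\rangle\Psi$ (resp. $[[A]]\Psi$) is a successor potential eventuality of it. $Real(\Phi,\Theta)$: conjunction/disjunction commute with $Real$; $Real(\varphi,\Theta)$ iff $\varphi\in\Theta$ (state formula); $Real(\bigcirc\varphi,\Theta)$ false; $Real(\Box\varphi,\Theta)$ iff $\varphi\in\Theta$; $Real(\varphi\,\mathcal{U}\,\psi,\Theta)$ iff $\psi\in\Theta$. A realization witness tree for $\xi=\langle\langle A\rangle\rangle\Phi\in H(s)$ at $s$ is a finite tree whose nodes $w$ are coloured by states $c(w)$ and carry potential eventualities $\xi_w=\langle\langle A\rangle\rangle\Phi_w\in H(c(w))$, with root coloured $s$ and carrying $\xi$, such that: at each interior node $w$ there is a successor potential eventuality $\xi'$ of $\xi_w$ with $\langle\langle A\rangle\rangle\bigcirc\xi'\in H(c(w))$ and an $A$-action $\sigma_A$ at $c(w)$ enforcing $\xi'$ (i.e. $\xi'\in H(t)$ for all $t\in\mathsf{Out}(c(w),\sigma_A)$), the children of $w$ being coloured bijectively by $\mathsf{Out}(c(w),\sigma_A)$ and carrying $\xi'$; at each leaf $w$, $Real(\Phi_w,H(c(w)))$ holds. For $\xi=[[A]]\Phi$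 the definition is the same with $[[A]]$ in place of $\langle\langle A\rangle\rangle$ and an $A$-co-action $\sigma^c_A$ in place of $\sigma_A$. A concurrent game Hintikka structure is a concurrent game structure with deterministic transitions whose states are labelled by sets $H(s)$ of $\mathrm{ATL}^{+}$ formulae such that for all $s$: (H1) $\varphi\in H(s)$ implies $\neg\varphi\notin H(s)$; (H2) if an $\alpha$-formula is in $H(s)$, both its $\alpha$-components are; (H3) if a $\beta$-formula is in $H(s)$, one of its $\beta$-components is; (H4) if a $\gamma$-formula is in $H(s)$, one of its $\gamma$-components is; (H5) if $\langle\langle A\rangle\rangle\bigcirc\psi\in H(s)$ there is an $A$-action $\sigma_A$ at $s$ with $\psi\in H(s')$ for all $s'\in\mathsf{Out}(s,\sigma_A)$, and if $[[A]]\bigcirc\psi\in H(s)$ there is an $A$-co-action $\sigma^c_A$ at $s$ with $\psi\in H(s')$ for all $s'\in\mathsf{Out}(s,\sigma^c_A)$; (H6) for every potential eventuality $\xi\in H(s)$ there is a realization witness tree for $\xi$ at $s$. It is a Hintikka structure for $\eta$ if $\eta\in H(s)$ for some state $s$.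
   Formalization: At an interior node of a realization witness tree, the successor potential eventuality must come from a pair ⟨ψ,Ψ⟩ in dec(Φ_w) with ψ also in H(c(w)); without this the statement fails, e.g. for Φ = x U b ∧ □x at a one-state loop labelled with x but not b. *)

theory Defs
  imports "HOL-Library.FuncSet"
begin

text \<open>
  The agents, the atoms and the states are the types \<open>'ag\<close>, \<open>'p\<close> and \<open>'s\<close>; a coalition is a set
  of agents. \<open>Strat A \<Phi>\<close> and \<open>CoStrat A \<Phi>\<close> stand for \<open>\<langle>\<langle>A\<rangle>\<rangle>\<Phi>\<close> and \<open>[[A]]\<Phi>\<close>, and \<open>PState\<close> is
  the inclusion of state formulae into path formulae.
\<close>

datatype ('ag, 'p) sfm =
    Atom 'p
  | NegAtom 'p
  | Or "('ag, 'p) sfm" "('ag, 'p) sfm"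
  | And "('ag, 'p) sfm" "('ag, 'p) sfm"
  | Strat "'ag set" "('ag, 'p) pfm"
  | CoStrat "'ag set" "('ag, 'p) pfm"
and ('ag, 'p) pfm =
    PState "('ag, 'p) sfm"
  | PNext "('ag, 'p) sfm"
  | PBox "('ag, 'p) sfm"
  | PUntil "('ag, 'p) sfm" "('ag, 'p) sfm"
  | POr "('ag, 'p) pfm" "('ag, 'p) pfm"
  | PAnd "('ag, 'p) pfm" "('ag, 'p) pfm"

text \<open>The atom in \<open>\<top> = p \<or> \<not>p\<close> is an arbitrary but fixed one.\<close>

definition top_atom :: 'p where
  "top_atom = (SOME p. True)"

definition Top :: "('ag, 'p) sfm" where
  "Top = Or (Atom top_atom) (NegAtom top_atom)"


section \<open>Concurrent game structures and models\<close>

record ('ag, 's, 'act) cgs =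
  Act :: "'ag \<Rightarrow> 'act set"
  act :: "'ag \<Rightarrow> 's \<Rightarrow> 'act set"
  out :: "'s \<Rightarrow> ('ag \<Rightarrow> 'act) \<Rightarrow> 's"

record ('ag, 's, 'act, 'p) cgm = "('ag, 's, 'act) cgs" +
  Lab :: "'s \<Rightarrow> 'p set"

record ('ag, 's, 'act, 'p) cghs = "('ag, 's, 'act) cgs" +
  Hint :: "'s \<Rightarrow> ('ag, 'p) sfm set"

definition cgs :: "('ag, 's, 'act, 'z) cgs_scheme \<Rightarrow> bool" where
  "cgs S \<longleftrightarrow> (\<forall>a s. act S a s \<noteq> {} \<and> act S a s \<subseteq> Act S a)"

text \<open>\<open>out S s \<sigma>\<close> is only ever used for \<open>\<sigma> \<in> actions S UNIV s\<close>, the action profiles at \<open>s\<close>.\<close>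

definition actions :: "('ag, 's, 'act, 'z) cgs_scheme \<Rightarrow> 'ag set \<Rightarrow> 's \<Rightarrow> ('ag \<Rightarrow> 'act) set" where
  "actions S A s = (\<Pi>\<^sub>E a\<in>A. act S a s)"

definition co_actions ::
    "('ag, 's, 'act, 'z) cgs_scheme \<Rightarrow> 'ag set \<Rightarrow> 's \<Rightarrow> (('ag \<Rightarrow> 'act) \<Rightarrow> ('ag \<Rightarrow> 'act)) set" where
  "co_actions S A s = (\<Pi>\<^sub>E \<sigma>\<in>actions S A s. actions S (- A) s)"

definition combine :: "'ag set \<Rightarrow> ('ag \<Rightarrow> 'act) \<Rightarrow> ('ag \<Rightarrow> 'act) \<Rightarrow> ('ag \<Rightarrow> 'act)" where
  "combine A \<sigma> \<tau> = (\<lambda>a. if a \<in> A then \<sigma> a else \<tau> a)"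

definition Out :: "('ag, 's, 'act, 'z) cgs_scheme \<Rightarrow> 'ag set \<Rightarrow> 's \<Rightarrow> ('ag \<Rightarrow> 'act) \<Rightarrow> 's set" where
  "Out S A s \<sigma>A = {out S s \<sigma> | \<sigma>. \<sigma> \<in> actions S UNIV s \<and> (\<forall>a\<in>A. \<sigma> a = \<sigma>A a)}"

definition co_Out ::
    "('ag, 's, 'act, 'z) cgs_scheme \<Rightarrow> 'ag set \<Rightarrow> 's \<Rightarrow> (('ag \<Rightarrow> 'act) \<Rightarrow> ('ag \<Rightarrow> 'act)) \<Rightarrow> 's set" where
  "co_Out S A s \<sigma>c = {out S s (combine A \<sigma>A (\<sigma>c \<sigma>A)) | \<sigma>A. \<sigma>A \<in> actions S A s}"

definition play :: "('ag, 's, 'act, 'z) cgs_scheme \<Rightarrow> (nat \<Rightarrow> 's) \<Rightarrow> bool" where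
  "play S \<pi> \<longleftrightarrow> (\<forall>i. \<exists>\<sigma>\<in>actions S UNIV (\<pi> i). \<pi> (Suc i) = out S (\<pi> i) \<sigma>)"

definition prefix :: "(nat \<Rightarrow> 's) \<Rightarrow> nat \<Rightarrow> 's list" where
  "prefix \<pi> i = map \<pi> [0..<Suc i]"

definition history :: "('ag, 's, 'act, 'z) cgs_scheme \<Rightarrow> 's list \<Rightarrow> bool" where
  "history S h \<longleftrightarrow> (\<exists>\<pi> i. play S \<pi> \<and> h = prefix \<pi> i)"

definition strategy ::
    "('ag, 's, 'act, 'z) cgs_scheme \<Rightarrow> 'ag set \<Rightarrow> ('s list \<Rightarrow> 'ag \<Rightarrow> 'act) \<Rightarrow> bool" where
  "strategy S A F \<longleftrightarrow> (\<forall>h. history S h \<longrightarrow> F h \<in> actions S A (last h))"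

definition consistent ::
    "('ag, 's, 'act, 'z) cgs_scheme \<Rightarrow> 'ag set \<Rightarrow> 's \<Rightarrow> ('s list \<Rightarrow> 'ag \<Rightarrow> 'act) \<Rightarrow> (nat \<Rightarrow> 's) \<Rightarrow> bool" where
  "consistent S A s F \<pi> \<longleftrightarrow> \<pi> 0 = s \<and> (\<forall>i. \<pi> (Suc i) \<in> Out S A (\<pi> i) (F (prefix \<pi> i)))"

definition co_strategy ::
    "('ag, 's, 'act, 'z) cgs_scheme \<Rightarrow> 'ag set \<Rightarrow>
     ('s list \<Rightarrow> ('s list \<Rightarrow> 'ag \<Rightarrow> 'act) \<Rightarrow> 'ag \<Rightarrow> 'act) \<Rightarrow> bool" where
  "co_strategy S A G \<longleftrightarrow>
     (\<forall>h F. history S h \<and> strategy S A F \<longrightarrow> G h F \<in> actions S (- A) (last h))"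

definition co_consistent ::
    "('ag, 's, 'act, 'z) cgs_scheme \<Rightarrow> 'ag set \<Rightarrow> 's \<Rightarrow>
     ('s list \<Rightarrow> ('s list \<Rightarrow> 'ag \<Rightarrow> 'act) \<Rightarrow> 'ag \<Rightarrow> 'act) \<Rightarrow> (nat \<Rightarrow> 's) \<Rightarrow> bool" where
  "co_consistent S A s G \<pi> \<longleftrightarrow> \<pi> 0 = s \<and>
     (\<exists>F. strategy S A F \<and>
       (\<forall>i. \<pi> (Suc i) = out S (\<pi> i) (combine A (F (prefix \<pi> i)) (G (prefix \<pi> i) F))))"

primrec sat :: "('ag, 's, 'act, 'p) cgm \<Rightarrow> 's \<Rightarrow> ('ag, 'p) sfm \<Rightarrow> bool"
  and psat :: "('ag, 's, 'act, 'p) cgm \<Rightarrow> (nat \<Rightarrow> 's) \<Rightarrow> ('ag, 'p) pfm \<Rightarrow> bool" where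
  "sat M s (Atom p) \<longleftrightarrow> p \<in> Lab M s"
| "sat M s (NegAtom p) \<longleftrightarrow> p \<notin> Lab M s"
| "sat M s (Or \<phi> \<psi>) \<longleftrightarrow> sat M s \<phi> \<or> sat M s \<psi>"
| "sat M s (And \<phi> \<psi>) \<longleftrightarrow> sat M s \<phi> \<and> sat M s \<psi>"
| "sat M s (Strat A \<Phi>) \<longleftrightarrow>
     (\<exists>F. strategy M A F \<and> (\<forall>\<pi>. consistent M A s F \<pi> \<longrightarrow> psat M \<pi> \<Phi>))"
| "sat M s (CoStrat A \<Phi>) \<longleftrightarrow>
     (\<exists>G. co_strategy M A G \<and> (\<forall>\<pi>. co_consistent M A s G \<pi> \<longrightarrow> psat M \<pi> \<Phi>))"
| "psat M \<pi> (PState \<phi>) \<longleftrightarrow> sat M (\<pi> 0) \<phi>"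
| "psat M \<pi> (PNext \<phi>) \<longleftrightarrow> sat M (\<pi> 1) \<phi>"
| "psat M \<pi> (PBox \<phi>) \<longleftrightarrow> (\<forall>i. sat M (\<pi> i) \<phi>)"
| "psat M \<pi> (PUntil \<phi> \<psi>) \<longleftrightarrow> (\<exists>i. sat M (\<pi> i) \<psi> \<and> (\<forall>j<i. sat M (\<pi> j) \<phi>))"
| "psat M \<pi> (POr \<Phi> \<Psi>) \<longleftrightarrow> psat M \<pi> \<Phi> \<or> psat M \<pi> \<Psi>"
| "psat M \<pi> (PAnd \<Phi> \<Psi>) \<longleftrightarrow> psat M \<pi> \<Phi> \<and> psat M \<pi> \<Psi>"


section \<open>Components, decomposition and realization\<close>

fun dec :: "('ag, 'p) pfm \<Rightarrow> (('ag, 'p) sfm \<times> ('ag, 'p) pfm) set" where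
  "dec (PState \<phi>) = {(\<phi>, PState Top)}"
| "dec (PNext \<phi>) = {(Top, PState \<phi>)}"
| "dec (PBox \<phi>) = {(\<phi>, PBox \<phi>)}"
| "dec (PUntil \<phi> \<psi>) = {(\<phi>, PUntil \<phi> \<psi>), (\<psi>, PState Top)}"
| "dec (PAnd \<Phi>1 \<Phi>2) =
     {(And \<psi>1 \<psi>2, PAnd \<Psi>1 \<Psi>2) | \<psi>1 \<psi>2 \<Psi>1 \<Psi>2. (\<psi>1, \<Psi>1) \<in> dec \<Phi>1 \<and> (\<psi>2, \<Psi>2) \<in> dec \<Phi>2}"
| "dec (POr \<Phi>1 \<Phi>2) = dec \<Phi>1 \<union> dec \<Phi>2 \<union>
     {(And \<psi>1 \<psi>2, POr \<Psi>1 \<Psi>2) | \<psi>1 \<psi>2 \<Psi>1 \<Psi>2. (\<psi>1, \<Psi>1) \<in> dec \<Phi>1 \<and> (\<psi>2, \<Psi>2) \<in> dec \<Phi>2 \<and>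
        \<Psi>1 \<noteq> PState Top \<and> \<Psi>2 \<noteq> PState Top}"

fun alpha_components :: "('ag, 'p) sfm \<Rightarrow> ('ag, 'p) sfm set" where
  "alpha_components (And \<phi> \<psi>) = {\<phi>, \<psi>}"
| "alpha_components (CoStrat A (PNext \<psi>)) = (if A = UNIV then {Strat {} (PNext \<psi>)} else {})"
| "alpha_components _ = {}"

fun is_next :: "('ag, 'p) pfm \<Rightarrow> bool" where
  "is_next (PNext \<phi>) \<longleftrightarrow> True"
| "is_next _ \<longleftrightarrow> False"

fun potential_eventuality :: "('ag, 'p) sfm \<Rightarrow> bool" where
  "potential_eventuality (Strat A \<Phi>) \<longleftrightarrow> \<not> is_next \<Phi>"
| "potential_eventuality (CoStrat A \<Phi>) \<longleftrightarrow> \<not> is_next \<Phi>"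
| "potential_eventuality _ \<longleftrightarrow> False"

text \<open>Below, \<open>Q\<close> is one of the operators \<open>Strat A\<close> and \<open>CoStrat A\<close>.\<close>

definition gamma_component ::
    "(('ag, 'p) pfm \<Rightarrow> ('ag, 'p) sfm) \<Rightarrow> ('ag, 'p) sfm \<Rightarrow> ('ag, 'p) pfm \<Rightarrow> ('ag, 'p) sfm" where
  "gamma_component Q \<psi> \<Psi> = (if \<Psi> = PState Top then \<psi> else And \<psi> (Q (PNext (Q \<Psi>))))"

fun gamma_components :: "('ag, 'p) sfm \<Rightarrow> ('ag, 'p) sfm set" where
  "gamma_components (Strat A \<Phi>) = {gamma_component (Strat A) \<psi> \<Psi> | \<psi> \<Psi>. (\<psi>, \<Psi>) \<in> dec \<Phi>}"
| "gamma_components (CoStrat A \<Phi>) = {gamma_component (CoStrat A) \<psi> \<Psi> | \<psi> \<Psi>. (\<psi>, \<Psi>) \<in> dec \<Phi>}"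
| "gamma_components _ = {}"

fun Real :: "('ag, 'p) pfm \<Rightarrow> ('ag, 'p) sfm set \<Rightarrow> bool" where
  "Real (PState \<phi>) \<Theta> \<longleftrightarrow> \<phi> \<in> \<Theta>"
| "Real (PNext \<phi>) \<Theta> \<longleftrightarrow> False"
| "Real (PBox \<phi>) \<Theta> \<longleftrightarrow> \<phi> \<in> \<Theta>"
| "Real (PUntil \<phi> \<psi>) \<Theta> \<longleftrightarrow> \<psi> \<in> \<Theta>"
| "Real (PAnd \<Phi> \<Psi>) \<Theta> \<longleftrightarrow> Real \<Phi> \<Theta> \<and> Real \<Psi> \<Theta>"
| "Real (POr \<Phi> \<Psi>) \<Theta> \<longleftrightarrow> Real \<Phi> \<Theta> \<or> Real \<Psi> \<Theta>"


section \<open>Realization witness trees\<close>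

text \<open>
  A node carries its colour and the path formula \<open>\<Phi>\<^sub>w\<close> of its potential eventuality
  \<open>\<xi>\<^sub>w = Q \<Phi>\<^sub>w\<close>. The order of the children is irrelevant; leaves are the nodes without children.
\<close>

datatype ('ag, 's, 'p) wtree =
  WNode (colour: 's) (carried: "('ag, 'p) pfm") (children: "('ag, 's, 'p) wtree list")

text \<open>
  The parameter \<open>moves s\<close> is the family of all outcome sets \<open>Out(s, \<sigma>\<^sub>A)\<close> (resp. \<open>Out(s, \<sigma>\<^sup>c\<^sub>A)\<close>).

  The successor \<open>Q \<Psi>\<close> used at an interior node comes from a pair \<open>(\<psi>, \<Psi>) \<in> dec \<Phi>\<close> whose present
  part \<open>\<psi>\<close> is in the label too, i.e. from a \<open>\<gamma>\<close>-component \<open>\<psi> \<and> Q\<circle>Q\<Psi>\<close> that holds in the label.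
  Without \<open>\<psi> \<in> H c\<close> a tree could discharge an until that is never fulfilled: take one state with
  one transition and \<open>\<Phi> = x U b \<and> \<box>x\<close>, where the label contains \<open>x\<close> but not \<open>b\<close>; the pair
  \<open>(b \<and> x, \<top> \<and> \<box>x)\<close> yields the successor \<open>Q(\<top> \<and> \<box>x)\<close>, which is realized at once.
\<close>

fun witness_tree ::
    "(('ag, 'p) pfm \<Rightarrow> ('ag, 'p) sfm) \<Rightarrow> ('s \<Rightarrow> 's set set) \<Rightarrow> ('s \<Rightarrow> ('ag, 'p) sfm set) \<Rightarrow>
     ('ag, 's, 'p) wtree \<Rightarrow> bool" where
  "witness_tree Q moves H (WNode c \<Phi> ts) \<longleftrightarrow>
     potential_eventuality (Q \<Phi>) \<and> Q \<Phi> \<in> H c \<and>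
     (if ts = [] then Real \<Phi> (H c)
      else (\<exists>\<psi> \<Psi>. (\<psi>, \<Psi>) \<in> dec \<Phi> \<and> \<Psi> \<noteq> PState Top \<and>
              \<psi> \<in> H c \<and> Q (PNext (Q \<Psi>)) \<in> H c \<and>
              (\<exists>X\<in>moves c. (\<forall>t\<in>X. Q \<Psi> \<in> H t) \<and>
                 distinct (map colour ts) \<and> set (map colour ts) = X \<and>
                 (\<forall>t\<in>set ts. carried t = \<Psi>)))) \<and>
     (\<forall>t\<in>set ts. witness_tree Q moves H t)"

definition strat_moves :: "('ag, 's, 'act, 'z) cgs_scheme \<Rightarrow> 'ag set \<Rightarrow> 's \<Rightarrow> 's set set" where
  "strat_moves S A s = {Out S A s \<sigma>A | \<sigma>A. \<sigma>A \<in> actions S A s}"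

definition co_strat_moves :: "('ag, 's, 'act, 'z) cgs_scheme \<Rightarrow> 'ag set \<Rightarrow> 's \<Rightarrow> 's set set" where
  "co_strat_moves S A s = {co_Out S A s \<sigma>c | \<sigma>c. \<sigma>c \<in> co_actions S A s}"

fun has_witness_tree :: "('ag, 's, 'act, 'p) cghs \<Rightarrow> 's \<Rightarrow> ('ag, 'p) sfm \<Rightarrow> bool" where
  "has_witness_tree S s (Strat A \<Phi>) \<longleftrightarrow>
     (\<exists>T. witness_tree (Strat A) (strat_moves S A) (Hint S) T \<and> colour T = s \<and> carried T = \<Phi>)"
| "has_witness_tree S s (CoStrat A \<Phi>) \<longleftrightarrow>
     (\<exists>T. witness_tree (CoStrat A) (co_strat_moves S A) (Hint S) T \<and> colour T = s \<and> carried T = \<Phi>)"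
| "has_witness_tree S s _ \<longleftrightarrow> False"


section \<open>Hintikka structures\<close>

text \<open>
  In negation normal form, \<open>\<not>\<phi>\<close> is a formula only for atomic \<open>\<phi>\<close>, so (H1) is about atoms.
\<close>

definition hintikka_structure :: "('ag, 's, 'act, 'p) cghs \<Rightarrow> bool" where
  "hintikka_structure S \<longleftrightarrow> cgs S \<and> (\<forall>s.
     (\<forall>p. Atom p \<in> Hint S s \<longrightarrow> NegAtom p \<notin> Hint S s) \<and>
     (\<forall>\<phi>\<in>Hint S s. alpha_components \<phi> \<subseteq> Hint S s) \<and>
     (\<forall>\<phi> \<psi>. Or \<phi> \<psi> \<in> Hint S s \<longrightarrow> \<phi> \<in> Hint S s \<or> \<psi> \<in> Hint S s) \<and>
     (\<forall>\<xi>\<in>Hint S s. potential_eventuality \<xi> \<longrightarrow> gamma_components \<xi> \<inter> Hint S s \<noteq> {}) \<and>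
     (\<forall>A \<psi>. Strat A (PNext \<psi>) \<in> Hint S s \<longrightarrow>
        (\<exists>\<sigma>A\<in>actions S A s. \<forall>t\<in>Out S A s \<sigma>A. \<psi> \<in> Hint S t)) \<and>
     (\<forall>A \<psi>. CoStrat A (PNext \<psi>) \<in> Hint S s \<longrightarrow>
        (\<exists>\<sigma>c\<in>co_actions S A s. \<forall>t\<in>co_Out S A s \<sigma>c. \<psi> \<in> Hint S t)) \<and>
     (\<forall>\<xi>\<in>Hint S s. potential_eventuality \<xi> \<longrightarrow> has_witness_tree S s \<xi>))"

definition hintikka_structure_for :: "('ag, 's, 'act, 'p) cghs \<Rightarrow> ('ag, 'p) sfm \<Rightarrow> bool" where
  "hintikka_structure_for S \<eta> \<longleftrightarrow> hintikka_structure S \<and> (\<exists>s. \<eta> \<in> Hint S s)"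

definition model_of :: "('ag, 's, 'act, 'p) cghs \<Rightarrow> ('ag, 's, 'act, 'p) cgm" where
  "model_of S = \<lparr>Act = Act S, act = act S, out = out S, Lab = (\<lambda>s. {p. Atom p \<in> Hint S s})\<rparr>"

end

theory Submission
  imports Defs
begin

text \<open>
  The coalition remembers only which path formula is still to be made true. While \<open>\<Phi>\<close> is pending
  at a state, it looks at a smallest witness tree for \<open>\<Phi>\<close> there. If the root is not a leaf, it makes
  the move of the root, so that the formula carried by the children becomes pending and has a
  smaller tree; if the root is a leaf, then \<open>\<Phi>\<close> is realized, and some \<open>\<gamma>\<close>-component in the label
  yields a move. Along a play the pending formulae \<open>\<Phi>\<^sub>0, \<Phi>\<^sub>1, \<dots>\<close> are such that \<open>\<Phi>\<^sub>i\<^sub>+\<^sub>1\<close> is the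
  second component of a pair in \<open>dec \<Phi>\<^sub>i\<close> whose first component holds at the \<open>i\<close>-th state. Each step
  either preserves the formula or makes it lighter, so the sequence is eventually constant. Tree
  sizes cannot decrease forever, so the constant value is realized at some late position; together
  with the first components that hold at all late positions this makes it true there, and truth
  travels back to \<open>\<Phi>\<^sub>0\<close> one step at a time.
\<close>

section \<open>Decomposition of path formulae\<close>

lemma pfm_induct [case_names PState PNext PBox PUntil POr PAnd]:
  assumes "\<And>\<phi>. P (PState \<phi>)" "\<And>\<phi>. P (PNext \<phi>)" "\<And>\<phi>. P (PBox \<phi>)" "\<And>\<phi> \<psi>. P (PUntil \<phi> \<psi>)"
    and "\<And>\<Phi> \<Psi>. P \<Phi> \<Longrightarrow> P \<Psi> \<Longrightarrow> P (POr \<Phi> \<Psi>)" "\<And>\<Phi> \<Psi>. P \<Phi> \<Longrightarrow> P \<Psi> \<Longrightarrow> P (PAnd \<Phi> \<Psi>)"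
  shows "P \<Phi>"
  by (rule pfm.induct[where ?P1.0 = "\<lambda>_. True"]) (simp_all add: assms)

primrec state_parts :: "('ag, 'p) pfm \<Rightarrow> ('ag, 'p) sfm set" where
  "state_parts (PState \<phi>) = {\<phi>}"
| "state_parts (PNext \<phi>) = {\<phi>}"
| "state_parts (PBox \<phi>) = {\<phi>}"
| "state_parts (PUntil \<phi> \<psi>) = {\<phi>, \<psi>}"
| "state_parts (POr \<Phi> \<Psi>) = state_parts \<Phi> \<union> state_parts \<Psi>"
| "state_parts (PAnd \<Phi> \<Psi>) = state_parts \<Phi> \<union> state_parts \<Psi>"

text \<open>The values \<open>3 > 2 > 1\<close> follow the descent \<open>\<circle>\<phi>\<close>, \<open>\<phi>\<close>, \<open>\<top>\<close> of remainders.\<close>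

primrec weight :: "('ag, 'p) pfm \<Rightarrow> nat" where
  "weight (PState \<phi>) = (if \<phi> = Top then 1 else 2)"
| "weight (PNext \<phi>) = 3"
| "weight (PBox \<phi>) = 1"
| "weight (PUntil \<phi> \<psi>) = 2"
| "weight (POr \<Phi> \<Psi>) = weight \<Phi> + weight \<Psi>"
| "weight (PAnd \<Phi> \<Psi>) = weight \<Phi> + weight \<Psi>"

lemma weight_pos: "0 < weight \<Phi>"
  by (induction \<Phi> rule: pfm_induct) auto

lemma dec_not_is_next: "(\<psi>, \<Psi>) \<in> dec \<Phi> \<Longrightarrow> \<not> is_next \<Psi>"
  by (induction \<Phi> arbitrary: \<psi> \<Psi> rule: pfm_induct) auto

lemma dec_state_parts: "(\<psi>, \<Psi>) \<in> dec \<Phi> \<Longrightarrow> state_parts \<Psi> \<subseteq> insert Top (state_parts \<Phi>)"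
  by (induction \<Phi> arbitrary: \<psi> \<Psi> rule: pfm_induct) (auto; blast)+

lemma dec_eq_or_weight_less: "(\<psi>, \<Psi>) \<in> dec \<Phi> \<Longrightarrow> \<Psi> = \<Phi> \<or> weight \<Psi> < weight \<Phi>"
proof (induction \<Phi> arbitrary: \<psi> \<Psi> rule: pfm_induct)
  case (POr \<Phi>1 \<Phi>2)
  then consider "\<Psi> = \<Phi>1 \<or> weight \<Psi> < weight \<Phi>1" | "\<Psi> = \<Phi>2 \<or> weight \<Psi> < weight \<Phi>2"
    | \<Psi>1 \<Psi>2 where "\<Psi> = POr \<Psi>1 \<Psi>2" "\<Psi>1 = \<Phi>1 \<or> weight \<Psi>1 < weight \<Phi>1"
        "\<Psi>2 = \<Phi>2 \<or> weight \<Psi>2 < weight \<Phi>2"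
    by auto
  then show ?case
    using weight_pos[of \<Phi>1] weight_pos[of \<Phi>2] by cases auto
next
  case (PAnd \<Phi>1 \<Phi>2)
  then obtain \<Psi>1 \<Psi>2 where "\<Psi> = PAnd \<Psi>1 \<Psi>2" "\<Psi>1 = \<Phi>1 \<or> weight \<Psi>1 < weight \<Phi>1"
      "\<Psi>2 = \<Phi>2 \<or> weight \<Psi>2 < weight \<Phi>2"
    by auto
  then show ?case by auto
qed auto

lemma Real_mono_state_parts: "Real \<Phi> \<Theta> \<Longrightarrow> state_parts \<Phi> \<inter> \<Theta> \<subseteq> \<Theta>' \<Longrightarrow> Real \<Phi> \<Theta>'"
  by (induction \<Phi> rule: pfm_induct) auto

definition residual :: "('ag, 'p) sfm set \<Rightarrow> ('ag, 'p) pfm \<Rightarrow> ('ag, 'p) pfm \<Rightarrow> bool" where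
  "residual \<Theta> \<Phi> \<Psi> \<longleftrightarrow> (\<exists>\<psi>\<in>\<Theta>. (\<psi>, \<Psi>) \<in> dec \<Phi>)"

lemma residual_eq_or_weight_less: "residual \<Theta> \<Phi> \<Psi> \<Longrightarrow> \<Psi> = \<Phi> \<or> weight \<Psi> < weight \<Phi>"
  using dec_eq_or_weight_less by (auto simp: residual_def)

lemma residual_state_parts: "residual \<Theta> \<Phi> \<Psi> \<Longrightarrow> state_parts \<Psi> \<subseteq> insert Top (state_parts \<Phi>)"
  using dec_state_parts by (auto simp: residual_def)

section \<open>Truth of a path formula along its residuals\<close>

definition truths :: "('ag, 's, 'act, 'p) cgm \<Rightarrow> 's \<Rightarrow> ('ag, 'p) sfm set" where
  "truths M s = {\<phi>. sat M s \<phi>}"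

lemma mem_truths [simp]: "\<phi> \<in> truths M s \<longleftrightarrow> sat M s \<phi>"
  by (simp add: truths_def)

lemma sat_Top [simp]: "sat M s Top"
  by (simp add: Top_def)

lemma psat_residual:
  assumes "residual (truths M (\<pi> 0)) \<Phi> \<Psi>" and "psat M (\<lambda>i. \<pi> (Suc i)) \<Psi>"
  shows "psat M \<pi> \<Phi>"
proof -
  obtain \<psi> where "(\<psi>, \<Psi>) \<in> dec \<Phi>" "sat M (\<pi> 0) \<psi>"
    using assms(1) by (auto simp: residual_def)
  then show ?thesis
    using assms(2)
  proof (induction \<Phi> arbitrary: \<psi> \<Psi> rule: pfm_induct)
    case (PBox \<phi>)
    then have "sat M (\<pi> i) \<phi>" for i
      by (cases i) auto
    then show ?case by simp
  next
    case (PUntil \<phi>1 \<phi>2)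
    then consider "sat M (\<pi> 0) \<phi>2"
      | i where "sat M (\<pi> 0) \<phi>1" "sat M (\<pi> (Suc i)) \<phi>2" "\<forall>j<i. sat M (\<pi> (Suc j)) \<phi>1"
      by auto
    then show ?case
    proof cases
      case 2
      then have "\<forall>j<Suc i. sat M (\<pi> j) \<phi>1"
        by (simp add: All_less_Suc2)
      with \<open>sat M (\<pi> (Suc i)) \<phi>2\<close> show ?thesis by auto
    qed auto
  next
    case (POr \<Phi>1 \<Phi>2)
    then show ?case by (auto; blast)
  qed auto
qed

lemma residual_PAnd_self:
  assumes "residual (truths M s) (PAnd \<Phi>1 \<Phi>2) (PAnd \<Phi>1 \<Phi>2)"
  shows "residual (truths M s) \<Phi>1 \<Phi>1" and "residual (truths M s) \<Phi>2 \<Phi>2"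
  using assms by (auto simp: residual_def)

lemma residual_POr_self:
  assumes "residual (truths M s) (POr \<Phi>1 \<Phi>2) (POr \<Phi>1 \<Phi>2)"
  shows "residual (truths M s) \<Phi>1 \<Phi>1" and "residual (truths M s) \<Phi>2 \<Phi>2"
proof -
  have "(\<psi>, POr \<Phi>1 \<Phi>2) \<notin> dec \<Phi>1 \<union> dec \<Phi>2" for \<psi>
    using dec_eq_or_weight_less[of \<psi> "POr \<Phi>1 \<Phi>2"] by fastforce
  with assms show "residual (truths M s) \<Phi>1 \<Phi>1" "residual (truths M s) \<Phi>2 \<Phi>2"
    by (auto simp: residual_def)
qed

lemma psat_of_residual_self:
  assumes "\<And>i. residual (truths M (\<pi> i)) \<Phi> \<Phi>" and "Real \<Phi> (truths M (\<pi> k))"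
  shows "psat M \<pi> \<Phi>"
  using assms
proof (induction \<Phi> rule: pfm_induct)
  case (POr \<Phi>1 \<Phi>2)
  then show ?case using residual_POr_self[OF POr.prems(1)] by auto
next
  case (PAnd \<Phi>1 \<Phi>2)
  then show ?case using residual_PAnd_self[OF PAnd.prems(1)] by auto
qed (auto simp: residual_def)

lemma eventually_constant_if_rank_descends:
  fixes rank :: "'a \<Rightarrow> 'b :: wellorder"
  assumes "\<And>i. f (Suc i) = f i \<or> rank (f (Suc i)) < rank (f i)"
  obtains N where "\<And>i. N \<le> i \<Longrightarrow> f i = f N"
proof -
  obtain N where N: "\<And>i. rank (f N) \<le> rank (f i)"
  proof -
    obtain v where "\<exists>N. v = rank (f N)" "\<forall>u<v. \<nexists>i. u = rank (f i)"
      using exists_least_iff[of "\<lambda>v. \<exists>i. v = rank (f i)"] by blast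
    then show ?thesis using that by (metis not_less)
  qed
  have "f i = f N" if "N \<le> i" for i
    using that
  proof (induction i rule: dec_induct)
    case (step i)
    then show ?case
      using assms[of i] N[of "Suc i"] by auto
  qed simp
  then show ?thesis using that by blast
qed

lemma infinitely_often_if_rank_descends:
  fixes rank :: "nat \<Rightarrow> 'a :: wellorder"
  assumes "\<And>i. P i \<or> rank (Suc i) < rank i"
  shows "\<exists>j\<ge>i. P j"
proof (induction "rank i" arbitrary: i rule: less_induct)
  case less
  then show ?case using assms[of i] Suc_leD by blast
qed

lemma psat_of_residual_run:
  assumes residual: "\<And>i. residual (truths M (\<pi> i)) (\<Phi> i) (\<Phi> (Suc i))"
    and recurrent: "\<And>i. \<exists>j\<ge>i. Real (\<Phi> j) (truths M (\<pi> j))"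
  shows "psat M \<pi> (\<Phi> 0)"
proof -
  obtain N where N: "\<And>i. N \<le> i \<Longrightarrow> \<Phi> i = \<Phi> N"
    using eventually_constant_if_rank_descends[of \<Phi> weight] residual_eq_or_weight_less[OF residual]
    by blast
  obtain k where "Real (\<Phi> N) (truths M (\<pi> (N + k)))"
    using recurrent[of N] N by (metis le_iff_add)
  moreover have "residual (truths M (\<pi> (N + i))) (\<Phi> N) (\<Phi> N)" for i
    using residual[of "N + i"] N[of "N + i"] N[of "Suc (N + i)"] by simp
  ultimately have "psat M (\<lambda>i. \<pi> (N + i)) (\<Phi> N)"
    by (intro psat_of_residual_self)
  with le0[of N] have "psat M (\<lambda>i. \<pi> (0 + i)) (\<Phi> 0)"
  proof (induction rule: inc_induct)
    case (step n)
    then show ?case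
      using residual[of n] by (intro psat_residual[where \<pi> = "\<lambda>i. \<pi> (n + i)" and \<Psi> = "\<Phi> (Suc n)"]) simp_all
  qed
  then show ?thesis by simp
qed

section \<open>Strategies as choices of outcome sets\<close>

lemma last_prefix [simp]: "last (prefix \<pi> i) = \<pi> i"
  by (simp add: prefix_def)

lemma prefix_0 [simp]: "prefix \<pi> 0 = [\<pi> 0]"
  by (simp add: prefix_def)

lemma prefix_not_Nil [simp]: "prefix \<pi> i \<noteq> []"
  by (simp add: prefix_def)

lemma prefix_Suc: "prefix \<pi> (Suc i) = prefix \<pi> i @ [\<pi> (Suc i)]"
  by (simp add: prefix_def)

definition policy :: "('s \<Rightarrow> 's set set) \<Rightarrow> ('s list \<Rightarrow> 's set) \<Rightarrow> bool" where
  "policy moves g \<longleftrightarrow> (\<forall>h. g h \<in> moves (last h))"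

definition follows :: "('s list \<Rightarrow> 's set) \<Rightarrow> (nat \<Rightarrow> 's) \<Rightarrow> bool" where
  "follows g \<pi> \<longleftrightarrow> (\<forall>i. \<pi> (Suc i) \<in> g (prefix \<pi> i))"

definition enforceable :: "('s \<Rightarrow> 's set set) \<Rightarrow> 's \<Rightarrow> ((nat \<Rightarrow> 's) \<Rightarrow> bool) \<Rightarrow> bool" where
  "enforceable moves s P \<longleftrightarrow> (\<exists>g. policy moves g \<and> (\<forall>\<pi>. \<pi> 0 = s \<longrightarrow> follows g \<pi> \<longrightarrow> P \<pi>))"

lemma enforceable_next:
  assumes "\<And>s. moves s \<noteq> {}" and "X \<in> moves s" and "\<And>\<pi>. \<pi> 1 \<in> X \<Longrightarrow> P \<pi>"
  shows "enforceable moves s P"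
  unfolding enforceable_def
proof (intro exI conjI allI impI)
  let ?g = "\<lambda>h. if h = [s] then X else (SOME Y. Y \<in> moves (last h))"
  show "policy moves ?g"
    using assms(1,2) by (simp add: policy_def some_in_eq)
  fix \<pi> :: "nat \<Rightarrow> 'a"
  assume "\<pi> 0 = s" "follows ?g \<pi>"
  then have "\<pi> 1 \<in> X"
    unfolding follows_def by (metis One_nat_def prefix_0)
  then show "P \<pi>" by (rule assms(3))
qed

lemma enforceable_by_automaton:
  fixes moves :: "'s \<Rightarrow> 's set set" and m\<^sub>0 :: 'm
  assumes move: "\<And>s m. move s m \<in> moves s"
    and win: "\<And>\<pi> m. \<lbrakk>\<pi> 0 = s\<^sub>0; m 0 = m\<^sub>0; \<And>i. m (Suc i) = update (\<pi> i) (m i) (\<pi> (Suc i));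
      \<And>i. \<pi> (Suc i) \<in> move (\<pi> i) (m i)\<rbrakk> \<Longrightarrow> P \<pi>"
  shows "enforceable moves s\<^sub>0 P"
proof -
  define position where "position h = foldl (\<lambda>(s, m) t. (t, update s m t)) (s\<^sub>0, m\<^sub>0) (tl h)" for h
  define memory where "memory h = snd (position h)" for h
  let ?g = "\<lambda>h. move (last h) (memory h)"
  have "policy moves ?g"
    using move by (simp add: policy_def)
  moreover have "P \<pi>" if start: "\<pi> 0 = s\<^sub>0" and follows: "follows ?g \<pi>" for \<pi>
  proof (rule win[where m = "\<lambda>i. memory (prefix \<pi> i)"])
    have "fst (position (prefix \<pi> i)) = \<pi> i" for i
      by (cases i) (simp_all add: position_def prefix_Suc start case_prod_beta)
    then show "memory (prefix \<pi> (Suc i)) = update (\<pi> i) (memory (prefix \<pi> i)) (\<pi> (Suc i))" for i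
      by (simp add: memory_def position_def prefix_Suc case_prod_beta)
    show "\<pi> (Suc i) \<in> move (\<pi> i) (memory (prefix \<pi> i))" for i
      using follows by (simp add: follows_def)
  qed (simp_all add: start memory_def position_def)
  ultimately show ?thesis unfolding enforceable_def by blast
qed

lemma enforceable_by_invariant:
  fixes moves :: "'s \<Rightarrow> 's set set" and m\<^sub>0 :: 'm
  assumes nonempty: "\<And>s. moves s \<noteq> {}"
    and init: "I s\<^sub>0 m\<^sub>0"
    and step: "\<And>s m. I s m \<Longrightarrow> \<exists>X\<in>moves s. \<forall>t\<in>X. \<exists>m'. I t m' \<and> R s m t m'"
    and win: "\<And>\<pi> m. \<lbrakk>\<pi> 0 = s\<^sub>0; m 0 = m\<^sub>0; \<And>i. R (\<pi> i) (m i) (\<pi> (Suc i)) (m (Suc i))\<rbrakk> \<Longrightarrow> P \<pi>"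
  shows "enforceable moves s\<^sub>0 P"
proof -
  have "\<exists>X\<in>moves s. I s m \<longrightarrow> (\<forall>t\<in>X. \<exists>m'. I t m' \<and> R s m t m')" for s m
    using step nonempty by blast
  then obtain move where move: "\<And>s m. move s m \<in> moves s"
    and "\<And>s m t. \<lbrakk>I s m; t \<in> move s m\<rbrakk> \<Longrightarrow> \<exists>m'. I t m' \<and> R s m t m'"
    by metis
  then obtain update where
    update: "\<And>s m t. \<lbrakk>I s m; t \<in> move s m\<rbrakk> \<Longrightarrow> I t (update s m t) \<and> R s m t (update s m t)"
    by metis
  from move show ?thesis
  proof (rule enforceable_by_automaton)
    fix \<pi> m
    assume start: "\<pi> 0 = s\<^sub>0" "m 0 = m\<^sub>0"
      and run: "\<And>i. m (Suc i) = update (\<pi> i) (m i) (\<pi> (Suc i))" "\<And>i. \<pi> (Suc i) \<in> move (\<pi> i) (m i)"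
    have "I (\<pi> i) (m i)" for i
    proof (induction i)
      case 0
      show ?case using init start by simp
    next
      case (Suc i)
      then show ?case using update run by simp
    qed
    then have "R (\<pi> i) (m i) (\<pi> (Suc i)) (m (Suc i))" for i
      using update run by simp
    with start show "P \<pi>" by (rule win)
  qed
qed

section \<open>Soundness of labels\<close>

definition sound ::
    "('ag, 's, 'act, 'p) cgm \<Rightarrow> ('s \<Rightarrow> ('ag, 'p) sfm set) \<Rightarrow> ('ag, 'p) sfm set" where
  "sound M H = {\<phi>. \<forall>s. \<phi> \<in> H s \<longrightarrow> sat M s \<phi>}"

lemma soundI: "(\<And>s. \<phi> \<in> H s \<Longrightarrow> sat M s \<phi>) \<Longrightarrow> \<phi> \<in> sound M H"
  by (simp add: sound_def)

lemma soundD: "\<lbrakk>\<phi> \<in> sound M H; \<phi> \<in> H s\<rbrakk> \<Longrightarrow> sat M s \<phi>"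
  by (simp add: sound_def)

lemma Real_truths:
  assumes "state_parts \<Phi> \<subseteq> sound M H" and "Real \<Phi> (H s)"
  shows "Real \<Phi> (truths M s)"
  using assms(2) by (rule Real_mono_state_parts) (use assms(1) in \<open>auto simp: sound_def\<close>)

lemma residual_state_parts_sound:
  assumes "residual \<Theta> \<Phi> \<Psi>" and "state_parts \<Phi> \<subseteq> sound M H"
  shows "state_parts \<Psi> \<subseteq> sound M H"
proof -
  have "Top \<in> sound M H" by (simp add: soundI)
  with residual_state_parts[OF assms(1)] assms(2) show ?thesis by blast
qed

locale conjunctive_labelling =
  fixes H :: "'s \<Rightarrow> ('ag, 'p) sfm set"
  assumes And_closed: "And \<phi> \<psi> \<in> H s \<Longrightarrow> \<phi> \<in> H s \<and> \<psi> \<in> H s"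
begin

lemma And_sound: "\<lbrakk>\<phi> \<in> sound M H; \<psi> \<in> sound M H\<rbrakk> \<Longrightarrow> And \<phi> \<psi> \<in> sound M H"
  by (auto simp: sound_def dest: And_closed)

lemma dec_sound: "\<lbrakk>(\<psi>, \<Psi>) \<in> dec \<Phi>; state_parts \<Phi> \<subseteq> sound M H\<rbrakk> \<Longrightarrow> \<psi> \<in> sound M H"
  by (induction \<Phi> arbitrary: \<psi> \<Psi> rule: pfm_induct) (auto intro: And_sound soundI)

lemma residual_truths:
  assumes "state_parts \<Phi> \<subseteq> sound M H" and "residual (H s) \<Phi> \<Psi>"
  shows "residual (truths M s) \<Phi> \<Psi>"
  using assms(2) dec_sound[OF _ assms(1)] soundD unfolding residual_def by (metis mem_truths)

end

section \<open>Enforcing eventualities\<close>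

locale eventuality_game = conjunctive_labelling H
  for H :: "'s \<Rightarrow> ('ag, 'p) sfm set" +
  fixes Q :: "('ag, 'p) pfm \<Rightarrow> ('ag, 'p) sfm"
    and moves :: "'s \<Rightarrow> 's set set"
  assumes moves_nonempty: "moves s \<noteq> {}"
    and potential_eventuality_iff: "potential_eventuality (Q \<Phi>) \<longleftrightarrow> \<not> is_next \<Phi>"
    and gamma_component_exists: "\<lbrakk>Q \<Phi> \<in> H s; \<not> is_next \<Phi>\<rbrakk> \<Longrightarrow>
      \<exists>\<psi> \<Psi>. (\<psi>, \<Psi>) \<in> dec \<Phi> \<and> gamma_component Q \<psi> \<Psi> \<in> H s"
    and next_move_exists: "Q (PNext \<phi>) \<in> H s \<Longrightarrow> \<exists>X\<in>moves s. \<forall>t\<in>X. \<phi> \<in> H t"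
    and witness_tree_exists: "\<lbrakk>Q \<Phi> \<in> H s; \<not> is_next \<Phi>\<rbrakk> \<Longrightarrow>
      \<exists>T. witness_tree Q moves H T \<and> colour T = s \<and> carried T = \<Phi>"
begin

definition realization_tree :: "'s \<Rightarrow> ('ag, 'p) pfm \<Rightarrow> ('ag, 's, 'p) wtree \<Rightarrow> bool" where
  "realization_tree s \<Phi> T \<longleftrightarrow> witness_tree Q moves H T \<and> colour T = s \<and> carried T = \<Phi>"

definition realization_rank :: "'s \<Rightarrow> ('ag, 'p) pfm \<Rightarrow> nat" where
  "realization_rank s \<Phi> = (LEAST n. \<exists>T. realization_tree s \<Phi> T \<and> size T = n)"

text \<open>The remainder \<open>\<top>\<close> means that the eventuality is fulfilled; \<open>Q \<top>\<close> need not be in the label.\<close>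

definition pending :: "'s \<Rightarrow> ('ag, 'p) pfm \<Rightarrow> bool" where
  "pending s \<Phi> \<longleftrightarrow> Q \<Phi> \<in> H s \<and> \<not> is_next \<Phi> \<or> \<Phi> = PState Top"

lemma realization_rank_le: "realization_tree s \<Phi> T \<Longrightarrow> realization_rank s \<Phi> \<le> size T"
  unfolding realization_rank_def by (blast intro: Least_le)

lemma smallest_realization_tree:
  assumes "Q \<Phi> \<in> H s" and "\<not> is_next \<Phi>"
  obtains T where "realization_tree s \<Phi> T" and "size T = realization_rank s \<Phi>"
proof -
  have "\<exists>n T. realization_tree s \<Phi> T \<and> size T = n"
    using witness_tree_exists[OF assms] by (simp add: realization_tree_def)
  then have "\<exists>T. realization_tree s \<Phi> T \<and> size T = realization_rank s \<Phi>"
    unfolding realization_rank_def by (rule LeastI_ex)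
  then show ?thesis using that by blast
qed

lemma gamma_move_exists:
  assumes "Q \<Phi> \<in> H s" and "\<not> is_next \<Phi>"
  shows "\<exists>X\<in>moves s. \<exists>\<Psi>. residual (H s) \<Phi> \<Psi> \<and> (\<forall>t\<in>X. pending t \<Psi>)"
proof -
  obtain \<psi> \<Psi> where dec: "(\<psi>, \<Psi>) \<in> dec \<Phi>" and component: "gamma_component Q \<psi> \<Psi> \<in> H s"
    using gamma_component_exists[OF assms] by blast
  show ?thesis
  proof (cases "\<Psi> = PState Top")
    case True
    then have "residual (H s) \<Phi> \<Psi>" "\<forall>t. pending t \<Psi>"
      using dec component by (auto simp: residual_def pending_def gamma_component_def)
    then show ?thesis using moves_nonempty[of s] by blast
  next
    case False
    then have "\<psi> \<in> H s" "Q (PNext (Q \<Psi>)) \<in> H s"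
      using component And_closed[of \<psi> "Q (PNext (Q \<Psi>))" s] by (simp_all add: gamma_component_def)
    moreover obtain X where "X \<in> moves s" "\<forall>t\<in>X. Q \<Psi> \<in> H t"
      using next_move_exists[OF \<open>Q (PNext (Q \<Psi>)) \<in> H s\<close>] by blast
    ultimately show ?thesis
      using dec dec_not_is_next[OF dec] unfolding residual_def pending_def by blast
  qed
qed

lemma tree_move_exists:
  assumes "realization_tree s \<Phi> T" and "children T \<noteq> []"
  shows "\<exists>X\<in>moves s. \<exists>\<Psi>. residual (H s) \<Phi> \<Psi> \<and>
    (\<forall>t\<in>X. pending t \<Psi> \<and> realization_rank t \<Psi> < size T)"
proof -
  obtain ts where T: "T = WNode s \<Phi> ts" "ts \<noteq> []"
    using assms by (cases T) (auto simp: realization_tree_def)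
  then obtain \<psi> \<Psi> where "(\<psi>, \<Psi>) \<in> dec \<Phi>" "\<psi> \<in> H s"
    and moves: "colour ` set ts \<in> moves s" and carried: "\<forall>T'\<in>set ts. carried T' = \<Psi>"
    using assms(1) by (auto simp: realization_tree_def)
  then have "residual (H s) \<Phi> \<Psi>" by (auto simp: residual_def)
  moreover have "pending (colour T') \<Psi> \<and> realization_rank (colour T') \<Psi> < size T"
    if "T' \<in> set ts" for T'
  proof
    have tree: "realization_tree (colour T') \<Psi> T'"
      using assms(1) T that carried by (simp add: realization_tree_def)
    then show "pending (colour T') \<Psi>"
      by (cases T') (auto simp: realization_tree_def pending_def potential_eventuality_iff)
    have "size T' < size T"
      using T that by (auto simp: less_Suc_eq_le intro!: trans_le_add2 size_list_estimation')
    with realization_rank_le[OF tree] show "realization_rank (colour T') \<Psi> < size T" by simp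
  qed
  ultimately show ?thesis using moves by blast
qed

lemma eventuality_move_exists:
  assumes "Q \<Phi> \<in> H s" and "\<not> is_next \<Phi>"
  shows "\<exists>X\<in>moves s. \<exists>\<Psi>. residual (H s) \<Phi> \<Psi> \<and>
    (\<forall>t\<in>X. pending t \<Psi> \<and> (Real \<Phi> (H s) \<or> realization_rank t \<Psi> < realization_rank s \<Phi>))"
proof -
  obtain T where T: "realization_tree s \<Phi> T" "size T = realization_rank s \<Phi>"
    using smallest_realization_tree[OF assms] .
  show ?thesis
  proof (cases "children T = []")
    case True
    then have "Real \<Phi> (H s)"
      using T(1) by (cases T) (auto simp: realization_tree_def)
    then show ?thesis using gamma_move_exists[OF assms] by blast
  next
    case False
    then show ?thesis using tree_move_exists[OF T(1)] T(2) by metis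
  qed
qed

lemma sound_move_exists:
  assumes "pending s \<Phi>" and sound: "state_parts \<Phi> \<subseteq> sound M H"
  shows "\<exists>X\<in>moves s. \<exists>\<Psi>. residual (truths M s) \<Phi> \<Psi> \<and> state_parts \<Psi> \<subseteq> sound M H \<and>
    (\<forall>t\<in>X. pending t \<Psi> \<and> (Real \<Phi> (truths M s) \<or> realization_rank t \<Psi> < realization_rank s \<Phi>))"
proof (cases "\<Phi> = PState Top")
  case True
  then have "residual (truths M s) \<Phi> \<Phi>" "Real \<Phi> (truths M s)" "\<forall>t. pending t \<Phi>"
    by (auto simp: residual_def pending_def)
  then show ?thesis using sound moves_nonempty[of s] by blast
next
  case False
  then obtain X \<Psi> where "X \<in> moves s" and residual: "residual (H s) \<Phi> \<Psi>"
    and "\<forall>t\<in>X. pending t \<Psi> \<and> (Real \<Phi> (H s) \<or> realization_rank t \<Psi> < realization_rank s \<Phi>)"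
    using eventuality_move_exists assms(1) unfolding pending_def by blast
  moreover have "residual (truths M s) \<Phi> \<Psi>"
    using sound residual by (rule residual_truths)
  moreover have "state_parts \<Psi> \<subseteq> sound M H"
    using residual sound by (rule residual_state_parts_sound)
  moreover have "Real \<Phi> (truths M s)" if "Real \<Phi> (H s)"
    using sound that by (rule Real_truths)
  ultimately show ?thesis by blast
qed

lemma enforceable_psat_of_pending:
  assumes "pending s \<Phi>" and "state_parts \<Phi> \<subseteq> sound M H"
  shows "enforceable moves s (\<lambda>\<pi>. psat M \<pi> \<Phi>)"
proof -
  let ?I = "\<lambda>s \<Phi>. pending s \<Phi> \<and> state_parts \<Phi> \<subseteq> sound M H"
  let ?R = "\<lambda>s \<Phi> t \<Psi>. residual (truths M s) \<Phi> \<Psi> \<and>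
    (Real \<Phi> (truths M s) \<or> realization_rank t \<Psi> < realization_rank s \<Phi>)"
  show ?thesis
  proof (rule enforceable_by_invariant[where I = ?I and R = ?R])
    show "moves s \<noteq> {}" for s
      by (rule moves_nonempty)
    show "?I s \<Phi>"
      using assms by simp
    show "\<exists>X\<in>moves s. \<forall>t\<in>X. \<exists>\<Psi>. ?I t \<Psi> \<and> ?R s \<Phi> t \<Psi>" if "?I s \<Phi>" for s \<Phi>
      using sound_move_exists[of s \<Phi> M] that by blast
  next
    fix \<pi> \<Phi>'
    assume "\<Phi>' 0 = \<Phi>" and run: "\<And>i. ?R (\<pi> i) (\<Phi>' i) (\<pi> (Suc i)) (\<Phi>' (Suc i))"
    have "psat M \<pi> (\<Phi>' 0)"
    proof (rule psat_of_residual_run)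
      show "residual (truths M (\<pi> i)) (\<Phi>' i) (\<Phi>' (Suc i))" for i
        using run by simp
      show "\<exists>j\<ge>i. Real (\<Phi>' j) (truths M (\<pi> j))" for i
        by (rule infinitely_often_if_rank_descends[where rank = "\<lambda>i. realization_rank (\<pi> i) (\<Phi>' i)"])
          (use run in simp)
    qed
    with \<open>\<Phi>' 0 = \<Phi>\<close> show "psat M \<pi> \<Phi>" by simp
  qed
qed

lemma enforceable_psat:
  assumes "Q \<Phi> \<in> H s" and "state_parts \<Phi> \<subseteq> sound M H"
  shows "enforceable moves s (\<lambda>\<pi>. psat M \<pi> \<Phi>)"
proof (cases "is_next \<Phi>")
  case True
  then obtain \<phi> where \<Phi>: "\<Phi> = PNext \<phi>" by (cases \<Phi>) auto
  then obtain X where X: "X \<in> moves s" "\<forall>t\<in>X. \<phi> \<in> H t"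
    using next_move_exists assms(1) by blast
  from moves_nonempty X(1) show ?thesis
    by (rule enforceable_next) (use X(2) assms(2) \<Phi> in \<open>auto intro: soundD\<close>)
next
  case False
  with assms show ?thesis by (intro enforceable_psat_of_pending) (simp_all add: pending_def)
qed

end

section \<open>From outcome sets to strategies and co-strategies\<close>

lemma actions_nonempty: "cgs S \<Longrightarrow> actions S A s \<noteq> {}"
  by (simp add: actions_def cgs_def PiE_eq_empty_iff)

lemma co_actions_nonempty: "cgs S \<Longrightarrow> co_actions S A s \<noteq> {}"
  using actions_nonempty by (fastforce simp: co_actions_def PiE_eq_empty_iff)

lemma strat_moves_nonempty: "cgs S \<Longrightarrow> strat_moves S A s \<noteq> {}"
  using actions_nonempty by (fastforce simp: strat_moves_def)

lemma co_strat_moves_nonempty: "cgs S \<Longrightarrow> co_strat_moves S A s \<noteq> {}"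
  using co_actions_nonempty by (fastforce simp: co_strat_moves_def)

lemma combine_in_actions:
  "\<lbrakk>\<sigma> \<in> actions S A s; \<tau> \<in> actions S (- A) s\<rbrakk> \<Longrightarrow> combine A \<sigma> \<tau> \<in> actions S UNIV s"
  by (auto simp: actions_def combine_def PiE_iff)

lemma play_exists:
  assumes "cgs S"
  obtains \<pi> where "play S \<pi>" and "\<pi> 0 = s"
proof -
  have "\<exists>t. \<exists>\<sigma>\<in>actions S UNIV s. t = out S s \<sigma>" for s
    using actions_nonempty[OF assms] by blast
  then obtain \<pi> where "\<pi> 0 = s" "\<And>i. \<exists>\<sigma>\<in>actions S UNIV (\<pi> i). \<pi> (Suc i) = out S (\<pi> i) \<sigma>"
    using dependent_nat_choice[of "\<lambda>i t. i = 0 \<longrightarrow> t = s"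
        "\<lambda>_ s t. \<exists>\<sigma>\<in>actions S UNIV s. t = out S s \<sigma>"] by blast
  then show ?thesis using that unfolding play_def by blast
qed

lemma history_prefix:
  assumes "cgs S"
    and step: "\<And>i. i < n \<Longrightarrow> \<exists>\<sigma>\<in>actions S UNIV (\<pi> i). \<pi> (Suc i) = out S (\<pi> i) \<sigma>"
  shows "history S (prefix \<pi> n)"
proof -
  obtain \<rho> where \<rho>: "play S \<rho>" "\<rho> 0 = \<pi> n"
    using play_exists[OF assms(1)] .
  define \<pi>' where "\<pi>' i = (if i \<le> n then \<pi> i else \<rho> (i - n))" for i
  have "\<exists>\<sigma>\<in>actions S UNIV (\<pi>' i). \<pi>' (Suc i) = out S (\<pi>' i) \<sigma>" for i
  proof (cases "i < n")
    case True
    then show ?thesis using step by (simp add: \<pi>'_def)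
  next
    case False
    then have "\<pi>' i = \<rho> (i - n)" "\<pi>' (Suc i) = \<rho> (Suc (i - n))"
      using \<rho>(2) by (auto simp: \<pi>'_def Suc_diff_le)
    then show ?thesis using \<rho>(1) by (simp add: play_def)
  qed
  then have "play S \<pi>'" by (simp add: play_def)
  moreover have "prefix \<pi> n = prefix \<pi>' n"
    by (auto simp: prefix_def \<pi>'_def)
  ultimately show ?thesis unfolding history_def by blast
qed

lemma history_prefix_combine:
  assumes "cgs S" and "strategy S A F" and "co_strategy S A G"
    and \<pi>: "\<And>i. \<pi> (Suc i) = out S (\<pi> i) (combine A (F (prefix \<pi> i)) (G (prefix \<pi> i) F))"
  shows "history S (prefix \<pi> n)"
proof (induction n rule: less_induct)
  case (less n)
  have "\<exists>\<sigma>\<in>actions S UNIV (\<pi> i). \<pi> (Suc i) = out S (\<pi> i) \<sigma>" if "i < n" for i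
  proof -
    have "F (prefix \<pi> i) \<in> actions S A (\<pi> i)" "G (prefix \<pi> i) F \<in> actions S (- A) (\<pi> i)"
      using less[OF that] assms(2,3) unfolding strategy_def co_strategy_def by fastforce+
    then have "combine A (F (prefix \<pi> i)) (G (prefix \<pi> i) F) \<in> actions S UNIV (\<pi> i)"
      by (rule combine_in_actions)
    with \<pi>[of i] show ?thesis by (rule bexI)
  qed
  with assms(1) show ?case by (rule history_prefix)
qed

lemma sat_Strat_if_enforceable:
  assumes "enforceable (strat_moves M A) s (\<lambda>\<pi>. psat M \<pi> \<Phi>)"
  shows "sat M s (Strat A \<Phi>)"
proof -
  obtain g where "policy (strat_moves M A) g"
    and win: "\<And>\<pi>. \<lbrakk>\<pi> 0 = s; follows g \<pi>\<rbrakk> \<Longrightarrow> psat M \<pi> \<Phi>"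
    using assms unfolding enforceable_def by blast
  then obtain F where F: "\<And>h. F h \<in> actions M A (last h)" "\<And>h. g h = Out M A (last h) (F h)"
    unfolding policy_def strat_moves_def by (simp add: set_eq_iff) metis
  have "strategy M A F"
    using F(1) by (simp add: strategy_def)
  moreover have "psat M \<pi> \<Phi>" if "consistent M A s F \<pi>" for \<pi>
    using that F(2) by (intro win) (simp_all add: consistent_def follows_def)
  ultimately show ?thesis by auto
qed

lemma sat_CoStrat_if_enforceable:
  assumes "cgs M" and "enforceable (co_strat_moves M A) s (\<lambda>\<pi>. psat M \<pi> \<Phi>)"
  shows "sat M s (CoStrat A \<Phi>)"
proof -
  obtain g where "policy (co_strat_moves M A) g"
    and win: "\<And>\<pi>. \<lbrakk>\<pi> 0 = s; follows g \<pi>\<rbrakk> \<Longrightarrow> psat M \<pi> \<Phi>"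
    using assms(2) unfolding enforceable_def by blast
  then obtain C where C: "\<And>h. C h \<in> co_actions M A (last h)" "\<And>h. g h = co_Out M A (last h) (C h)"
    unfolding policy_def co_strat_moves_def by (simp add: set_eq_iff) metis
  let ?G = "\<lambda>h F. C h (F h)"
  have G: "co_strategy M A ?G"
    using C(1) unfolding co_strategy_def strategy_def co_actions_def by (metis PiE_mem)
  moreover have "psat M \<pi> \<Phi>" if consistent: "co_consistent M A s ?G \<pi>" for \<pi>
  proof -
    obtain F where F: "\<pi> 0 = s" "strategy M A F"
      and \<pi>: "\<And>i. \<pi> (Suc i) = out M (\<pi> i) (combine A (F (prefix \<pi> i)) (?G (prefix \<pi> i) F))"
      using consistent unfolding co_consistent_def by blast
    have "F (prefix \<pi> i) \<in> actions M A (\<pi> i)" for i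
    proof -
      have "history M (prefix \<pi> i)"
        using assms(1) F(2) G by (rule history_prefix_combine) (rule \<pi>)
      with F(2) show ?thesis by (fastforce simp: strategy_def)
    qed
    then have "follows g \<pi>"
      using \<pi> by (auto simp: follows_def C(2) co_Out_def)
    with F(1) show ?thesis by (rule win)
  qed
  ultimately show ?thesis by auto
qed

section \<open>Truth of the labels of a Hintikka structure\<close>

lemma model_of_simps [simp]:
  "cgs (model_of S) = cgs S"
  "strat_moves (model_of S) = strat_moves S"
  "co_strat_moves (model_of S) = co_strat_moves S"
  "Lab (model_of S) s = {p. Atom p \<in> Hint S s}"
  by (simp_all add: model_of_def cgs_def fun_eq_iff strat_moves_def co_strat_moves_def actions_def
      co_actions_def Out_def co_Out_def)

lemma
  assumes "hintikka_structure S"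
  shows hintikka_cgs: "cgs S"
    and hintikka_literal: "NegAtom p \<in> Hint S s \<Longrightarrow> Atom p \<notin> Hint S s"
    and hintikka_alpha: "\<phi> \<in> Hint S s \<Longrightarrow> alpha_components \<phi> \<subseteq> Hint S s"
    and hintikka_Or: "Or \<phi> \<psi> \<in> Hint S s \<Longrightarrow> \<phi> \<in> Hint S s \<or> \<psi> \<in> Hint S s"
    and hintikka_gamma:
      "\<lbrakk>\<phi> \<in> Hint S s; potential_eventuality \<phi>\<rbrakk> \<Longrightarrow> gamma_components \<phi> \<inter> Hint S s \<noteq> {}"
    and hintikka_Strat_next:
      "Strat A (PNext \<phi>) \<in> Hint S s \<Longrightarrow> \<exists>\<sigma>A\<in>actions S A s. \<forall>t\<in>Out S A s \<sigma>A. \<phi> \<in> Hint S t"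
    and hintikka_CoStrat_next:
      "CoStrat A (PNext \<phi>) \<in> Hint S s \<Longrightarrow> \<exists>\<sigma>c\<in>co_actions S A s. \<forall>t\<in>co_Out S A s \<sigma>c. \<phi> \<in> Hint S t"
    and hintikka_witness_tree:
      "\<lbrakk>\<phi> \<in> Hint S s; potential_eventuality \<phi>\<rbrakk> \<Longrightarrow> has_witness_tree S s \<phi>"
  using assms[unfolded hintikka_structure_def, THEN conjunct1]
    assms[unfolded hintikka_structure_def, THEN conjunct2, THEN spec[of _ s]]
  by meson+

lemma hintikka_conjunctive_labelling:
  assumes "hintikka_structure S"
  shows "conjunctive_labelling (Hint S)"
proof
  fix \<phi> \<psi> s
  assume "And \<phi> \<psi> \<in> Hint S s"
  then show "\<phi> \<in> Hint S s \<and> \<psi> \<in> Hint S s"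
    using hintikka_alpha[OF assms, of "And \<phi> \<psi>" s] by simp
qed

lemma hintikka_eventuality_game:
  assumes S: "hintikka_structure S"
    and "\<And>s. moves s \<noteq> {}"
    and "\<And>\<Phi>. potential_eventuality (Q \<Phi>) \<longleftrightarrow> \<not> is_next \<Phi>"
    and "\<And>\<Phi>. gamma_components (Q \<Phi>) = {gamma_component Q \<psi> \<Psi> | \<psi> \<Psi>. (\<psi>, \<Psi>) \<in> dec \<Phi>}"
    and "\<And>\<phi> s. Q (PNext \<phi>) \<in> Hint S s \<Longrightarrow> \<exists>X\<in>moves s. \<forall>t\<in>X. \<phi> \<in> Hint S t"
    and "\<And>\<Phi> s. has_witness_tree S s (Q \<Phi>) \<longleftrightarrow>
      (\<exists>T. witness_tree Q moves (Hint S) T \<and> colour T = s \<and> carried T = \<Phi>)"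
  shows "eventuality_game (Hint S) Q moves"
proof -
  interpret conjunctive_labelling "Hint S"
    by (rule hintikka_conjunctive_labelling[OF S])
  show ?thesis
  proof
    fix \<Phi> s
    assume "Q \<Phi> \<in> Hint S s" "\<not> is_next \<Phi>"
    then show "\<exists>\<psi> \<Psi>. (\<psi>, \<Psi>) \<in> dec \<Phi> \<and> gamma_component Q \<psi> \<Psi> \<in> Hint S s"
      and "\<exists>T. witness_tree Q moves (Hint S) T \<and> colour T = s \<and> carried T = \<Phi>"
      using hintikka_gamma[OF S, of "Q \<Phi>" s] hintikka_witness_tree[OF S, of "Q \<Phi>" s] assms(3,4,6)
      by auto
  qed (fact assms)+
qed

lemma hintikka_Strat_sound:
  assumes "hintikka_structure S" and "state_parts \<Phi> \<subseteq> sound (model_of S) (Hint S)"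
  shows "Strat A \<Phi> \<in> sound (model_of S) (Hint S)"
proof (intro soundI sat_Strat_if_enforceable)
  interpret eventuality_game "Hint S" "Strat A" "strat_moves S A"
  proof (rule hintikka_eventuality_game[OF assms(1)])
    show "strat_moves S A s \<noteq> {}" for s
      by (rule strat_moves_nonempty[OF hintikka_cgs[OF assms(1)]])
    show "\<exists>X\<in>strat_moves S A s. \<forall>t\<in>X. \<phi> \<in> Hint S t" if "Strat A (PNext \<phi>) \<in> Hint S s" for \<phi> s
      using hintikka_Strat_next[OF assms(1) that] by (auto simp: strat_moves_def)
  qed (rule potential_eventuality.simps gamma_components.simps has_witness_tree.simps)+
  fix s
  assume "Strat A \<Phi> \<in> Hint S s"
  then show "enforceable (strat_moves (model_of S) A) s (\<lambda>\<pi>. psat (model_of S) \<pi> \<Phi>)"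
    using enforceable_psat assms(2) by simp
qed

lemma hintikka_CoStrat_sound:
  assumes "hintikka_structure S" and "state_parts \<Phi> \<subseteq> sound (model_of S) (Hint S)"
  shows "CoStrat A \<Phi> \<in> sound (model_of S) (Hint S)"
proof (intro soundI sat_CoStrat_if_enforceable)
  interpret eventuality_game "Hint S" "CoStrat A" "co_strat_moves S A"
  proof (rule hintikka_eventuality_game[OF assms(1)])
    show "co_strat_moves S A s \<noteq> {}" for s
      by (rule co_strat_moves_nonempty[OF hintikka_cgs[OF assms(1)]])
    show "\<exists>X\<in>co_strat_moves S A s. \<forall>t\<in>X. \<phi> \<in> Hint S t" if "CoStrat A (PNext \<phi>) \<in> Hint S s" for \<phi> s
      using hintikka_CoStrat_next[OF assms(1) that] by (auto simp: co_strat_moves_def)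
  qed (rule potential_eventuality.simps gamma_components.simps has_witness_tree.simps)+
  fix s
  assume "CoStrat A \<Phi> \<in> Hint S s"
  then show "enforceable (co_strat_moves (model_of S) A) s (\<lambda>\<pi>. psat (model_of S) \<pi> \<Phi>)"
    using enforceable_psat assms(2) by simp
qed (simp add: hintikka_cgs assms(1))

lemma hintikka_sound:
  fixes S :: "('ag, 's, 'act, 'p) cghs"
  assumes "hintikka_structure S"
  shows "\<phi> \<in> sound (model_of S) (Hint S)"
    and "state_parts \<Phi> \<subseteq> sound (model_of S) (Hint S)"
proof (induction \<phi> and \<Phi>)
  case (Atom p)
  show ?case by (rule soundI) simp
next
  case (NegAtom p)
  show ?case by (rule soundI) (use hintikka_literal[OF assms, of p] in simp)
next
  case (Or \<phi> \<psi>)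
  then show ?case using hintikka_Or[OF assms, of \<phi> \<psi>] by (auto simp: sound_def)
next
  case (And \<phi> \<psi>)
  then show ?case
    by (rule conjunctive_labelling.And_sound[OF hintikka_conjunctive_labelling[OF assms]])
next
  case (Strat A \<Phi>)
  with assms show ?case by (rule hintikka_Strat_sound)
next
  case (CoStrat A \<Phi>)
  with assms show ?case by (rule hintikka_CoStrat_sound)
qed simp_all

theorem theorem3:
  fixes S :: "('ag, 's, 'act, 'p) cghs" and \<eta> :: "('ag, 'p) sfm"
  assumes "hintikka_structure_for S \<eta>"
  shows "(\<forall>s \<phi>. \<phi> \<in> Hint S s \<longrightarrow> sat (model_of S) s \<phi>) \<and> (\<exists>s. sat (model_of S) s \<eta>)"
proof -
  have S: "hintikka_structure S" and "\<exists>s. \<eta> \<in> Hint S s"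
    using assms by (simp_all add: hintikka_structure_for_def)
  then show ?thesis
    using soundD[OF hintikka_sound(1)[OF S]] by blast
qed

end
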